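(* Let $A_N$ be the matrix defined in the context, built with the scaled monomials, the Bessel functions of the first kind, or the modified Bessel functions of the first kind as basis functions. Assume that there is a constant $c\in\mathbb{R}$ such that $$\|g^{(\ell)}(0)\|\le c\,\|A\|^\ell\quad\text{for all }\ell\ge 0 .$$ Then, with $a_N=\begin{bmatrix}I_n&0\end{bmatrix}r_N(tA_N)\begin{bmatrix}u_0\\ e_1\end{bmatrix}$, where $r_N(z)=\sum_{\ell=N}^\infty z^\ell/\ell!$, one has $a_N\to0$ as $N\to\infty$ (for each fixed $t\ge0$).
   Context: $\|\cdot\|$ is the Euclidean vector norm or spectral matrix norm, and $e_1$ is the first unit vector of consistent size. $A\in\mathbb{C}^{n\times n}$, $u_0\in\mathbb{C}^n$, and $g:\mathbb{C}\to\mathbb{C}^n$ has entire components and is expanded as $g(s)=\sum_{\ell=0}^\infty w_\ell\phi_\ell(s)$ with $w_\ell\in\mathbb{C}^n$. $W_N=[w_0\ \cdots\ w_{N-1}]\in\mathbb{C}^{n\times N}$ and $$A_N=\begin{bmatrix}A&W_N\\0&H_N\end{bmatrix}\in\mathbb{C}^{(n+N)\times(n+N)}.$$ The basis functions $\phi_\ell$ and matrices $H_N\in\mathbb{R}^{N\times N}$ are one of: (i) scaled monomials $\phi_\ell(t)=t^\ell/\ell!$, with $H_N$ having ones on the first subdiagonal and zeros elsewhere; (ii) Bessel functions $\phi_\ell(t)=J_\ell(t)=\frac1\pi\int_0^\pi\cos(\ell\tau-t\sin\tau)\,d\tau$, with $H_N$ tridiagonal with zero diagonal, subdiagonal entries $\tfrac12$,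 $(H_N)_{1,2}=-1$ and remaining superdiagonal entries $-\tfrac12$; (iii) modified Bessel functions $\phi_\ell(t)=I_\ell(t)=(-\mathrm i)^\ell J_\ell(\mathrm it)$, with $H_N$ tridiagonal with zero diagonal, subdiagonal entries $\tfrac12$, $(H_N)_{1,2}=1$ and remaining superdiagonal entries $\tfrac12$. In all these cases $g^{(\ell)}(0)=W_NH_N^\ell e_1$ for $\ell<N$. *)

theory Defs
  imports "HOL-Complex_Analysis.Complex_Analysis" "Jordan_Normal_Form.Matrix"
begin

text \<open>
  The size of the augmented matrix varies within one statement, so vectors and matrices are
  those of \<^theory>\<open>Jordan_Normal_Form.Matrix\<close>, with explicit dimensions and indices
  starting at 0. Names that also exist in HOL-Analysis are qualified.
\<close>

definition vec_nrm :: "complex Matrix.vec \<Rightarrow> real" where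
  "vec_nrm v = sqrt (\<Sum>i<dim_vec v. (cmod (vec_index v i))\<^sup>2)"

text \<open>Taking the whole unit ball, not only the sphere, keeps the set nonempty in dimension 0.\<close>

definition spectral_nrm :: "complex Matrix.mat \<Rightarrow> real" where
  "spectral_nrm A =
     Sup {vec_nrm (A *\<^sub>v x) | x. x \<in> carrier_vec (dim_col A) \<and> vec_nrm x \<le> 1}"

definition bessel_J :: "nat \<Rightarrow> complex \<Rightarrow> complex" where
  "bessel_J l t =
     1 / of_real pi *
       integral {0..pi} (\<lambda>\<tau>. cos (of_nat l * of_real \<tau> - t * of_real (sin \<tau>)))"

definition bessel_I :: "nat \<Rightarrow> complex \<Rightarrow> complex" where
  "bessel_I l t = (- \<i>) ^ l * bessel_J l (\<i> * t)"

datatype basis_family = Monomials | Bessel | Modified_Bessel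

fun basis_fun :: "basis_family \<Rightarrow> nat \<Rightarrow> complex \<Rightarrow> complex" where
  "basis_fun Monomials l t = t ^ l / fact l"
| "basis_fun Bessel l t = bessel_J l t"
| "basis_fun Modified_Bessel l t = bessel_I l t"

fun basis_mat :: "basis_family \<Rightarrow> nat \<Rightarrow> real Matrix.mat" where
  "basis_mat Monomials N =
     Matrix.mat N N (\<lambda>(i, j). if i = j + 1 then 1 else 0)"
| "basis_mat Bessel N =
     Matrix.mat N N (\<lambda>(i, j).
       if i = j + 1 then 1 / 2
       else if j = i + 1 then (if i = 0 then - 1 else - 1 / 2)
       else 0)"
| "basis_mat Modified_Bessel N =
     Matrix.mat N N (\<lambda>(i, j).
       if i = j + 1 then 1 / 2
       else if j = i + 1 then (if i = 0 then 1 else 1 / 2)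
       else 0)"

definition coeff_mat :: "nat \<Rightarrow> (nat \<Rightarrow> complex Matrix.vec) \<Rightarrow> nat \<Rightarrow> complex Matrix.mat" where
  "coeff_mat n w N = mat_of_cols n (map w [0..<N])"

definition augmented_mat ::
  "basis_family \<Rightarrow> nat \<Rightarrow> complex Matrix.mat \<Rightarrow> (nat \<Rightarrow> complex Matrix.vec) \<Rightarrow> nat \<Rightarrow> complex Matrix.mat" where
  "augmented_mat b n A w N =
     four_block_mat A (coeff_mat n w N) (0\<^sub>m N n) (map_mat complex_of_real (basis_mat b N))"

text \<open>
  The tail \<open>r\<^sub>N(M)\<close> of the matrix exponential of a square matrix, summed entrywise; it always
  converges.
\<close>

definition exp_tail :: "nat \<Rightarrow> complex Matrix.mat \<Rightarrow> complex Matrix.mat" where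
  "exp_tail N M =
     Matrix.mat (dim_row M) (dim_row M)
       (\<lambda>(i, j). \<Sum>k. (M ^\<^sub>m (N + k)) $$ (i, j) / fact (N + k))"

text \<open>The block row \<open>[I\<^sub>n 0]\<close> with \<open>n + N\<close> columns.\<close>

definition first_block_proj :: "nat \<Rightarrow> nat \<Rightarrow> complex Matrix.mat" where
  "first_block_proj n N = Matrix.mat n (n + N) (\<lambda>(i, j). if i = j then 1 else 0)"

definition exp_remainder ::
  "basis_family \<Rightarrow> nat \<Rightarrow> complex Matrix.mat \<Rightarrow> (nat \<Rightarrow> complex Matrix.vec) \<Rightarrow> complex Matrix.vec
     \<Rightarrow> real \<Rightarrow> nat \<Rightarrow> complex Matrix.vec" where
  "exp_remainder b n A w u0 t N =
     first_block_proj n N *\<^sub>v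
       (exp_tail N (complex_of_real t \<cdot>\<^sub>m augmented_mat b n A w N) *\<^sub>v
         (u0 @\<^sub>v unit_vec N 0))"

definition vec_deriv ::
  "nat \<Rightarrow> nat \<Rightarrow> (complex \<Rightarrow> complex Matrix.vec) \<Rightarrow> complex \<Rightarrow> complex Matrix.vec" where
  "vec_deriv n l g z = Matrix.vec n (\<lambda>i. (deriv ^^ l) (\<lambda>s. vec_index (g s) i) z)"

end

theory Submission
  imports Defs
begin

text \<open>
  The heart of the matter is that the growth bound on the derivatives of \<open>g\<close> at 0 forces the
  coefficient vectors to grow at most geometrically: every entry of \<open>w\<^sub>l\<close> is bounded by \<open>K \<rho>\<^sup>l\<close> with
  \<open>\<rho> = 2 \<parallel>A\<parallel> + 1\<close>. For the monomials this is immediate, as \<open>w\<^sub>l\<close> is the \<open>l\<close>-th derivative. The Bessel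
  case reduces to the modified Bessel case through the substitution \<open>s \<mapsto> \<i> s\<close>. In the modified
  Bessel case the identity \<open>I\<^sub>m' = (I\<^bsub>m-1\<^esub> + I\<^bsub>m+1\<^esub>) / 2\<close> shows that the \<open>k\<close>-th derivative of \<open>I\<^sub>m\<close>
  at 0 is the probability that a simple random walk on the integers is at \<open>m\<close> after \<open>k\<close> steps. These
  numbers are nonnegative and vanish for \<open>k < m\<close>, so \<open>I\<^sub>m\<close> is in modulus on the unit disc at most
  \<open>2\<^sup>-\<^sup>m I\<^sub>m(2)\<close>. Convergence of the expansion at the single point 2 therefore yields uniform
  convergence on the unit disc, and the expansion can be differentiated termwise
  (\<open>sums_higher_deriv_dominated\<close>). Formally \<open>I\<^sub>m\<close> is the \<open>m\<close>-th cosine coefficient of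
  \<open>\<tau> \<mapsto> exp (s cos \<tau>)\<close>, on which the Chebyshev polynomial \<open>T\<^sub>l(d/ds)\<close> acts as multiplication by
  \<open>cos (l \<tau>)\<close>; evaluation at 0 then isolates the \<open>l\<close>-th coefficient (\<open>walk_series_inversion\<close>).
  The three-term recursion of \<open>T\<^sub>l\<close> turns the bound on the derivatives into the bound on \<open>w\<^sub>l\<close>.

  The matrix half uses a weighted \<open>\<ell>\<^sup>1\<close>-norm: the first \<open>n\<close> coordinates have weight 1 and
  the \<open>j\<close>-th of the remaining \<open>N\<close> coordinates, counted from 0, has weight \<open>\<rho>\<^sup>j\<close>. The weight absorbs the growth of the \<open>w\<^sub>j\<close>,
  and the basis matrices only couple neighbouring indices, so the operator norm of \<open>A\<^sub>N\<close> is bounded by a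
  constant \<open>R\<close> independent of \<open>N\<close> (\<open>augmented_mat_weighted_col_sum_le\<close>). The starting vector
  has norm at most \<open>\<parallel>u\<^sub>0\<parallel>\<^sub>1 + 1\<close>, because its unit vector sits at weight \<open>\<rho>\<^sup>0\<close>. Hence every component of
  \<open>a\<^sub>N\<close> is at most a constant times \<open>\<Sum>k\<ge>N. (t R)\<^sup>k / k!\<close>, the tail of a convergent series.
\<close>

section \<open>Termwise differentiation of dominated expansions\<close>

lemma higher_deriv_linear_combination:
  fixes f :: "'a \<Rightarrow> complex \<Rightarrow> complex"
  assumes "finite I" "\<And>i. i \<in> I \<Longrightarrow> f i holomorphic_on UNIV"
  shows "(deriv ^^ k) (\<lambda>z. \<Sum>i\<in>I. a i * f i z) z = (\<Sum>i\<in>I. a i * (deriv ^^ k) (f i) z)"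
  using assms
proof (induction I rule: finite_induct)
  case empty
  have "(deriv ^^ k) (\<lambda>z. 0) = (\<lambda>z. 0 :: complex)"
    by (induction k) auto
  then show ?case by simp
next
  case (insert j I)
  have "(deriv ^^ k) (\<lambda>z. a j * f j z + (\<Sum>i\<in>I. a i * f i z)) z
      = (deriv ^^ k) (\<lambda>z. a j * f j z) z + (deriv ^^ k) (\<lambda>z. \<Sum>i\<in>I. a i * f i z) z"
    using insert.prems by (intro higher_deriv_add[where S = UNIV] holomorphic_intros) auto
  also have "(deriv ^^ k) (\<lambda>z. a j * f j z) z = a j * (deriv ^^ k) (f j) z"
    using insert.prems by (intro higher_deriv_cmult[where A = UNIV]) auto
  finally show ?case
    using insert by simp
qed

text \<open>
  Pointwise convergence alone does not permit termwise differentiation. If, however, the functions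
  decay geometrically on the unit disc relative to their values at one point \<open>z\<^sub>0\<close>, then convergence at
  \<open>z\<^sub>0\<close> bounds the coefficients well enough for the Weierstrass test on the disc.
\<close>
lemma sums_higher_deriv_dominated:
  fixes \<phi> :: "nat \<Rightarrow> complex \<Rightarrow> complex"
  assumes hol: "\<And>m. \<phi> m holomorphic_on UNIV"
    and dom: "\<And>m s. norm s < 1 \<Longrightarrow> norm (\<phi> m s) \<le> (1/2) ^ m * norm (\<phi> m z\<^sub>0)"
    and sums: "\<And>s. (\<lambda>m. a m * \<phi> m s) sums f s"
  shows "(\<lambda>m. a m * (deriv ^^ k) (\<phi> m) 0) sums (deriv ^^ k) f 0"
proof -
  have "(\<lambda>m. a m * \<phi> m z\<^sub>0) \<longlonglongrightarrow> 0"
    using sums[of z\<^sub>0] summable_LIMSEQ_zero sums_summable by blast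
  then have "Bseq (\<lambda>m. a m * \<phi> m z\<^sub>0)"
    using convergent_imp_Bseq convergentI by blast
  then obtain K where K: "\<And>m. norm (a m * \<phi> m z\<^sub>0) \<le> K"
    by (auto simp: Bseq_def)
  have "norm (a m * \<phi> m s) \<le> K * (1/2) ^ m" if "s \<in> ball 0 1" for m s
  proof -
    have "norm (a m * \<phi> m s) \<le> norm (a m) * ((1/2) ^ m * norm (\<phi> m z\<^sub>0))"
      unfolding norm_mult using dom[of s m] that by (intro mult_left_mono) auto
    also have "\<dots> = norm (a m * \<phi> m z\<^sub>0) * (1/2) ^ m"
      by (simp add: norm_mult)
    also have "\<dots> \<le> K * (1/2) ^ m"
      by (intro mult_right_mono K) auto
    finally show ?thesis .
  qed
  then have "uniform_limit (ball 0 1) (\<lambda>n s. \<Sum>m<n. a m * \<phi> m s)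
      (\<lambda>s. \<Sum>m. a m * \<phi> m s) sequentially"
    by (rule Weierstrass_m_test) (auto intro!: summable_mult summable_geometric)
  also have "(\<lambda>s. \<Sum>m. a m * \<phi> m s) = f"
    using sums by (auto simp: sums_iff)
  finally have "(\<lambda>n. (deriv ^^ k) (\<lambda>s. \<Sum>m<n. a m * \<phi> m s) 0) \<longlonglongrightarrow> (deriv ^^ k) f 0"
    using hol
    by (intro higher_deriv_complex_uniform_limit[where A = "ball 0 1"])
       (auto intro!: holomorphic_intros always_eventually intro: holomorphic_on_subset)
  then show ?thesis
    using hol by (simp add: sums_def higher_deriv_linear_combination)
qed

section \<open>Random walk numbers and their inversion by Chebyshev recursion\<close>

text \<open>
  The distribution of a simple symmetric random walk on the integers after \<open>k\<close> steps, which will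
  turn out to be the Taylor data of the modified Bessel functions. Indexing by integers lets one
  recursion cover the boundary case \<open>m = 0\<close>.
\<close>
primrec walk :: "nat \<Rightarrow> int \<Rightarrow> real" where
  "walk 0 m = (if m = 0 then 1 else 0)"
| "walk (Suc k) m = (walk k (m - 1) + walk k (m + 1)) / 2"

lemma walk_nonneg: "0 \<le> walk k m"
  by (induction k arbitrary: m) auto

lemma walk_eq_0: "int k < \<bar>m\<bar> \<Longrightarrow> walk k m = 0"
  by (induction k arbitrary: m) auto

text \<open>
  The sequence \<open>d\<close> lists the derivatives of a function at 0, so that shifting it is
  differentiation; the operator then gives the derivatives of \<open>T\<^sub>l(d/ds) f\<close>, with \<open>T\<^sub>l\<close> the Chebyshev
  polynomial of the first kind.
\<close>
fun chebyshev_op :: "nat \<Rightarrow> (nat \<Rightarrow> complex) \<Rightarrow> nat \<Rightarrow> complex" where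
  "chebyshev_op 0 d k = d k"
| "chebyshev_op (Suc 0) d k = d (Suc k)"
| "chebyshev_op (Suc (Suc l)) d k = 2 * chebyshev_op (Suc l) d (Suc k) - chebyshev_op l d k"

text \<open>
  The rate \<open>\<beta> = 2 \<alpha> + 1\<close> satisfies \<open>2 \<alpha> \<beta> + 1 \<le> \<beta>\<^sup>2\<close>, which is all that the three-term
  recursion requires.
\<close>
lemma norm_chebyshev_op_le:
  assumes "\<And>k. norm (d k) \<le> c * \<alpha> ^ k" and [simp]: "0 \<le> c" "0 \<le> \<alpha>"
  shows "norm (chebyshev_op l d k) \<le> c * \<alpha> ^ k * (2 * \<alpha> + 1) ^ l"
proof (induction l arbitrary: k rule: induct_nat_012)
  case 1
  have "norm (d (Suc k)) \<le> c * \<alpha> ^ k * \<alpha>"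
    using assms(1)[of "Suc k"] by (simp add: mult_ac)
  also have "\<dots> \<le> c * \<alpha> ^ k * (2 * \<alpha> + 1)"
    by (intro mult_left_mono) auto
  finally show ?case by simp
next
  case (ge2 l)
  let ?\<beta> = "2 * \<alpha> + 1"
  have "norm (chebyshev_op (Suc (Suc l)) d k)
      \<le> 2 * norm (chebyshev_op (Suc l) d (Suc k)) + norm (chebyshev_op l d k)"
    by (simp add: norm_triangle_ineq4[THEN order_trans] norm_mult)
  also have "\<dots> \<le> 2 * (c * \<alpha> ^ Suc k * ?\<beta> ^ Suc l) + c * \<alpha> ^ k * ?\<beta> ^ l"
    using ge2.IH(2)[of "Suc k"] ge2.IH(1)[of k] by linarith
  also have "\<dots> = c * \<alpha> ^ k * ?\<beta> ^ l * (2 * \<alpha> * ?\<beta> + 1)"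
    by (simp add: algebra_simps)
  also have "\<dots> \<le> c * \<alpha> ^ k * ?\<beta> ^ l * ?\<beta> ^ 2"
    by (intro mult_left_mono) (auto simp: power2_eq_square algebra_simps)
  finally show ?case
    by (simp add: power2_eq_square mult_ac)
qed (use assms in auto)

text \<open>
  This is the product formula \<open>2 cos (l \<tau>) cos (m \<tau>) = cos ((m + l) \<tau>) + cos ((m - l) \<tau>)\<close> on the
  level of Taylor data.
\<close>
lemma chebyshev_op_walk:
  "chebyshev_op l (\<lambda>k. complex_of_real (walk k m)) k
     = complex_of_real ((walk k (m + int l) + walk k (m - int l)) / 2)"
proof (induction l arbitrary: k rule: induct_nat_012)
  case (ge2 l)
  then show ?case
    by (simp add: algebra_simps add_divide_distrib)
qed (auto simp: algebra_simps)

lemma sums_chebyshev_op: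
  assumes "\<And>k. (\<lambda>m. a m * h m k) sums d k"
  shows "(\<lambda>m. a m * chebyshev_op l (h m) k) sums chebyshev_op l d k"
proof (induction l arbitrary: k rule: induct_nat_012)
  case (ge2 l)
  have "(\<lambda>m. 2 * (a m * chebyshev_op (Suc l) (h m) (Suc k)) - a m * chebyshev_op l (h m) k)
      sums (2 * chebyshev_op (Suc l) d (Suc k) - chebyshev_op l d k)"
    using ge2.IH by (intro sums_diff sums_mult)
  then show ?case
    by (simp add: algebra_simps)
qed (use assms in auto)

text \<open>
  At \<open>k = 0\<close> the walk sits at the origin, so the product formula leaves only the term \<open>m = l\<close>, with
  factor 1/2 unless \<open>l = 0\<close>: this is the orthogonality of the cosines.
\<close>
lemma walk_series_inversion:
  assumes "\<And>k. (\<lambda>m. a m * complex_of_real (walk k (int m))) sums d k"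
  shows "a l = (if l = 0 then 1 else 2) * chebyshev_op l d 0"
proof -
  have "(\<lambda>m. a m * chebyshev_op l (\<lambda>k. complex_of_real (walk k (int m))) 0)
      sums chebyshev_op l d 0"
    by (rule sums_chebyshev_op) (rule assms)
  moreover have "(\<lambda>m. a m * chebyshev_op l (\<lambda>k. complex_of_real (walk k (int m))) 0)
      = (\<lambda>m. if m = l then a l * (if l = 0 then 1 else 1 / 2) else 0)"
    by (auto simp: chebyshev_op_walk fun_eq_iff)
  ultimately have "chebyshev_op l d 0 = a l * (if l = 0 then 1 else 1 / 2)"
    using sums_unique2 sums_single[of l "\<lambda>_. a l * (if l = 0 then 1 else 1 / 2)"] by force
  then show ?thesis
    by auto
qed

section \<open>Taylor data of the Bessel functions\<close>

lemma integral_cos_eq_0: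
  assumes "m \<noteq> 0"
  shows "integral {0..pi} (\<lambda>\<tau>. cos (of_nat m * complex_of_real \<tau>)) = 0"
proof -
  have "((\<lambda>\<tau>. cos (of_nat m * complex_of_real \<tau>)) has_integral
      sin (of_nat m * complex_of_real pi) / of_nat m - sin (of_nat m * complex_of_real 0) / of_nat m) {0..pi}"
    using assms
    by (intro fundamental_theorem_of_calculus)
       (auto intro!: derivative_eq_intros has_vector_derivative_real_field simp: field_simps)
  moreover have "sin (of_nat m * complex_of_real pi) = 0"
    by (metis of_real_0 of_real_mult of_real_of_nat_eq sin_npi sin_of_real)
  ultimately show ?thesis
    by (simp add: integral_unique)
qed

text \<open>
  The integrand is the derivative of \<open>sin (t sin \<tau>) / t\<close>. This integral is the difference between the
  two integral representations of \<open>-J\<^sub>0'\<close> and \<open>J\<^sub>1\<close>.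
\<close>
lemma integral_cos_cos_sin_eq_0:
  "integral {0..pi} (\<lambda>\<tau>. cos (complex_of_real \<tau>) * cos (t * complex_of_real (sin \<tau>))) = 0"
proof (cases "t = 0")
  case True
  then show ?thesis
    using integral_cos_eq_0[of 1] by simp
next
  case False
  have "((\<lambda>\<tau>. cos (complex_of_real \<tau>) * cos (t * sin (complex_of_real \<tau>))) has_integral
      sin (t * sin (complex_of_real pi)) / t - sin (t * sin (complex_of_real 0)) / t) {0..pi}"
    using False
    by (intro fundamental_theorem_of_calculus)
       (auto intro!: derivative_eq_intros has_vector_derivative_real_field simp: field_simps)
  then show ?thesis
    by (simp add: integral_unique sin_of_real)
qed

lemma has_field_derivative_bessel_J_integral:
  "(bessel_J m has_field_derivative
     1 / of_real pi * integral {0..pi} (\<lambda>\<tau>. of_real (sin \<tau>) *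
       sin (of_nat m * of_real \<tau> - t * of_real (sin \<tau>)))) (at t)"
proof -
  have "((\<lambda>t. integral (cbox 0 pi) (\<lambda>\<tau>. cos (of_nat m * of_real \<tau> - t * of_real (sin \<tau>))))
      has_field_derivative integral (cbox 0 pi) (\<lambda>\<tau>. of_real (sin \<tau>) *
       sin (of_nat m * of_real \<tau> - t * of_real (sin \<tau>)))) (at t within UNIV)"
    by (rule leibniz_rule_field_derivative)
       (auto intro!: derivative_eq_intros integrable_continuous_real continuous_intros
         simp: case_prod_beta)
  then show ?thesis
    unfolding bessel_J_def by (auto intro!: derivative_eq_intros)
qed

lemma bessel_J_integrable:
  "(\<lambda>\<tau>. cos (of_nat m * of_real \<tau> - t * complex_of_real (sin \<tau>))) integrable_on {0..pi}"
  by (intro integrable_continuous_real continuous_intros)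

lemma has_field_derivative_bessel_J_0: "(bessel_J 0 has_field_derivative - bessel_J 1 t) (at t)"
proof -
  let ?S = "\<lambda>\<tau>. complex_of_real (sin \<tau>)"
  have "cos (of_nat 1 * of_real \<tau> - t * ?S \<tau>)
      = cos (of_real \<tau>) * cos (t * ?S \<tau>) - ?S \<tau> * sin (of_nat 0 * of_real \<tau> - t * ?S \<tau>)" for \<tau>
    by (simp add: cos_diff sin_of_real)
  then have "integral {0..pi} (\<lambda>\<tau>. cos (of_nat 1 * of_real \<tau> - t * ?S \<tau>))
      = integral {0..pi} (\<lambda>\<tau>. cos (of_real \<tau>) * cos (t * ?S \<tau>))
        - integral {0..pi} (\<lambda>\<tau>. ?S \<tau> * sin (of_nat 0 * of_real \<tau> - t * ?S \<tau>))"
    by (simp only:)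
       (intro integral_diff integrable_continuous_real continuous_intros)
  then have "bessel_J 1 t = - (1 / of_real pi *
      integral {0..pi} (\<lambda>\<tau>. ?S \<tau> * sin (of_nat 0 * of_real \<tau> - t * ?S \<tau>)))"
    by (simp add: bessel_J_def integral_cos_cos_sin_eq_0)
  then show ?thesis
    using has_field_derivative_bessel_J_integral[of 0 t] by simp
qed

lemma has_field_derivative_bessel_J_Suc:
  "(bessel_J (Suc m) has_field_derivative (bessel_J m t - bessel_J (Suc (Suc m)) t) / 2) (at t)"
proof -
  let ?S = "\<lambda>\<tau>. complex_of_real (sin \<tau>)"
  let ?c = "\<lambda>m \<tau>. cos (of_nat m * of_real \<tau> - t * ?S \<tau>)"
  have "?S \<tau> * sin (of_nat (Suc m) * of_real \<tau> - t * ?S \<tau>) = (?c m \<tau> - ?c (Suc (Suc m)) \<tau>) / 2" for \<tau>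
  proof -
    define x where "x = of_nat (Suc m) * of_real \<tau> - t * ?S \<tau>"
    have "of_nat m * of_real \<tau> - t * ?S \<tau> = x - of_real \<tau>"
         "of_nat (Suc (Suc m)) * of_real \<tau> - t * ?S \<tau> = x + of_real \<tau>"
      by (simp_all add: x_def algebra_simps)
    then show ?thesis
      unfolding x_def[symmetric] by (simp add: cos_add cos_diff sin_of_real)
  qed
  then have "integral {0..pi} (\<lambda>\<tau>. ?S \<tau> * sin (of_nat (Suc m) * of_real \<tau> - t * ?S \<tau>))
      = integral {0..pi} (\<lambda>\<tau>. (?c m \<tau> - ?c (Suc (Suc m)) \<tau>) / 2)"
    by (simp only:)
  also have "\<dots> = (integral {0..pi} (?c m) - integral {0..pi} (?c (Suc (Suc m)))) / 2"
    by (subst integral_divide, subst integral_diff) (rule bessel_J_integrable refl)+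
  finally have "1 / of_real pi * integral {0..pi} (\<lambda>\<tau>. ?S \<tau> * sin (of_nat (Suc m) * of_real \<tau> - t * ?S \<tau>))
      = (bessel_J m t - bessel_J (Suc (Suc m)) t) / 2"
    by (simp add: bessel_J_def field_simps)
  then show ?thesis
    using has_field_derivative_bessel_J_integral[of "Suc m" t] by (simp only:)
qed

lemma bessel_I_0: "bessel_I m 0 = (if m = 0 then 1 else 0)"
  using integral_cos_eq_0[of m] by (auto simp: bessel_I_def bessel_J_def scaleR_conv_of_real)

text \<open>The absolute value encodes \<open>I\<^bsub>-1\<^esub> = I\<^sub>1\<close>, which enters for \<open>m = 0\<close>.\<close>
lemma has_field_derivative_bessel_I:
  "(bessel_I m has_field_derivative
     (bessel_I (nat \<bar>int m - 1\<bar>) t + bessel_I (m + 1) t) / 2) (at t)"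
proof (cases m)
  case 0
  have "((\<lambda>t. bessel_J 0 (\<i> * t)) has_field_derivative - bessel_J 1 (\<i> * t) * \<i>) (at t)"
    by (rule DERIV_chain2[OF has_field_derivative_bessel_J_0]) (auto intro!: derivative_eq_intros)
  then have "((\<lambda>t. (- \<i>) ^ 0 * bessel_J 0 (\<i> * t)) has_field_derivative bessel_I 1 t) (at t)"
    by (simp add: bessel_I_def mult.commute)
  then show ?thesis
    by (simp add: 0 bessel_I_def[abs_def])
next
  case (Suc l)
  have "((\<lambda>t. bessel_J (Suc l) (\<i> * t)) has_field_derivative
      (bessel_J l (\<i> * t) - bessel_J (Suc (Suc l)) (\<i> * t)) / 2 * \<i>) (at t)"
    by (rule DERIV_chain2[OF has_field_derivative_bessel_J_Suc]) (auto intro!: derivative_eq_intros)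
  then have "((\<lambda>t. (- \<i>) ^ Suc l * bessel_J (Suc l) (\<i> * t)) has_field_derivative
      (- \<i>) ^ Suc l * ((bessel_J l (\<i> * t) - bessel_J (Suc (Suc l)) (\<i> * t)) / 2 * \<i>)) (at t)"
    by (rule DERIV_cmult)
  also have "(- \<i>) ^ Suc l * ((bessel_J l (\<i> * t) - bessel_J (Suc (Suc l)) (\<i> * t)) / 2 * \<i>)
      = (bessel_I l t + bessel_I (l + 2) t) / 2"
    by (simp add: bessel_I_def algebra_simps)
  finally have "((\<lambda>t. (- \<i>) ^ Suc l * bessel_J (Suc l) (\<i> * t)) has_field_derivative
      (bessel_I l t + bessel_I (l + 2) t) / 2) (at t)" .
  then show ?thesis
    by (simp add: Suc bessel_I_def[abs_def])
qed

lemma holomorphic_bessel_I: "bessel_I m holomorphic_on UNIV"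
  using has_field_derivative_bessel_I[of m] by (auto simp: holomorphic_on_open)

text \<open>
  Since \<open>I\<^bsub>-m\<^esub> = I\<^sub>m\<close>, reading \<open>I\<^sub>j\<close> as \<open>I\<^bsub>\<bar>j\<bar>\<^esub>\<close> for integers \<open>j\<close> makes the derivative rule uniform in
  \<open>j\<close>, and it becomes the step rule of the random walk.
\<close>
lemma higher_deriv_bessel_I_0: "(deriv ^^ k) (bessel_I m) 0 = complex_of_real (walk k (int m))"
proof -
  have "(deriv ^^ k) (bessel_I (nat \<bar>j\<bar>)) 0 = complex_of_real (walk k j)" for j :: int
  proof (induction k arbitrary: j)
    case 0
    then show ?case by (simp add: bessel_I_0)
  next
    case (Suc k)
    have "deriv (bessel_I (nat \<bar>j\<bar>)) t
        = 1/2 * (bessel_I (nat \<bar>j - 1\<bar>) t + bessel_I (nat \<bar>j + 1\<bar>) t)" for t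
    proof -
      have "deriv (bessel_I (nat \<bar>j\<bar>)) t
          = (bessel_I (nat \<bar>int (nat \<bar>j\<bar>) - 1\<bar>) t + bessel_I (nat \<bar>j\<bar> + 1) t) / 2"
        by (intro DERIV_imp_deriv has_field_derivative_bessel_I)
      also have "\<dots> = 1/2 * (bessel_I (nat \<bar>j - 1\<bar>) t + bessel_I (nat \<bar>j + 1\<bar>) t)"
      proof (cases "1 \<le> j")
        case True
        then have "nat \<bar>int (nat \<bar>j\<bar>) - 1\<bar> = nat \<bar>j - 1\<bar>" "nat \<bar>j\<bar> + 1 = nat \<bar>j + 1\<bar>"
          by linarith+
        then show ?thesis by (simp only:) simp
      next
        case False
        then have "nat \<bar>int (nat \<bar>j\<bar>) - 1\<bar> = nat \<bar>j + 1\<bar>" "nat \<bar>j\<bar> + 1 = nat \<bar>j - 1\<bar>"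
          by linarith+
        then show ?thesis by (simp only:) simp
      qed
      finally show ?thesis .
    qed
    then have "deriv (bessel_I (nat \<bar>j\<bar>))
        = (\<lambda>t. 1/2 * (bessel_I (nat \<bar>j - 1\<bar>) t + bessel_I (nat \<bar>j + 1\<bar>) t))"
      by (rule ext)
    then have "(deriv ^^ Suc k) (bessel_I (nat \<bar>j\<bar>)) 0
        = (deriv ^^ k) (\<lambda>t. 1/2 * (bessel_I (nat \<bar>j - 1\<bar>) t + bessel_I (nat \<bar>j + 1\<bar>) t)) 0"
      by (simp only: funpow_Suc_right o_def)
    also have "\<dots> = 1/2 * ((deriv ^^ k) (bessel_I (nat \<bar>j - 1\<bar>)) 0
        + (deriv ^^ k) (bessel_I (nat \<bar>j + 1\<bar>)) 0)"
      by (subst higher_deriv_cmult[where A = UNIV])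
         (auto intro!: holomorphic_intros holomorphic_bessel_I higher_deriv_add[where S = UNIV])
    finally show ?case
      by (simp add: Suc.IH)
  qed
  from this[of "int m"] show ?thesis
    by simp
qed

lemma bessel_I_sums:
  "(\<lambda>k. complex_of_real (walk k (int m)) / fact k * t ^ k) sums bessel_I m t"
  using holomorphic_power_series[of "bessel_I m" 0 "norm t + 1" t]
    holomorphic_on_subset[OF holomorphic_bessel_I]
  by (auto simp: higher_deriv_bessel_I_0)

text \<open>
  All Taylor coefficients are nonnegative and those of order below \<open>m\<close> vanish; each surviving
  monomial shrinks by at least \<open>2\<^sup>-\<^sup>m\<close> when passing from 2 into the unit disc.
\<close>
lemma norm_bessel_I_le:
  assumes "norm s < 1"
  shows "norm (bessel_I m s) \<le> (1/2) ^ m * norm (bessel_I m 2)"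
proof -
  let ?h = "\<lambda>k. walk k (int m) / fact k"
  have "(\<lambda>k. complex_of_real (?h k * 2 ^ k)) sums bessel_I m 2"
    using bessel_I_sums[of m 2] by simp
  from sums_Re[OF this] have S: "(\<lambda>k. ?h k * 2 ^ k) sums Re (bessel_I m 2)"
    by (simp only: Re_complex_of_real)
  have le: "norm (complex_of_real (walk k (int m)) / fact k * s ^ k) \<le> (1/2) ^ m * (?h k * 2 ^ k)" for k
  proof (cases "k < m")
    case True
    then show ?thesis by (simp add: walk_eq_0)
  next
    case False
    have "norm (complex_of_real (walk k (int m)) / fact k * s ^ k) = ?h k * norm s ^ k"
      by (simp add: norm_mult norm_divide norm_power walk_nonneg)
    also have "\<dots> \<le> ?h k * 1"
      using assms by (intro mult_left_mono power_le_one) (auto simp: walk_nonneg)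
    also have "\<dots> \<le> ?h k * ((1/2) ^ m * 2 ^ k)"
    proof (rule mult_left_mono)
      have "(1/2) ^ m * (2::real) ^ k = 2 ^ (k - m)"
        using False by (simp add: power_diff power_one_over field_simps)
      then show "1 \<le> (1/2) ^ m * (2::real) ^ k" by simp
    qed (auto simp: walk_nonneg)
    finally show ?thesis
      by (simp only: mult_ac)
  qed
  have "norm (bessel_I m s) \<le> (1/2) ^ m * Re (bessel_I m 2)"
    using bessel_I_sums[of m s] sums_mult[OF S, of "(1/2) ^ m"] le
    by (metis (no_types, lifting) norm_sums_le)
  also have "\<dots> \<le> (1/2) ^ m * norm (bessel_I m 2)"
    by (intro mult_left_mono complex_Re_le_cmod) auto
  finally show ?thesis .
qed

section \<open>Geometric growth of the expansion coefficients\<close>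

lemma modified_bessel_coeff_le:
  assumes sums: "\<And>s. (\<lambda>l. a l * bessel_I l s) sums f s"
    and bound: "\<And>k. norm ((deriv ^^ k) f 0) \<le> c * \<alpha> ^ k" and "0 \<le> c" "0 \<le> \<alpha>"
  shows "norm (a l) \<le> 2 * c * (2 * \<alpha> + 1) ^ l"
proof -
  have "(\<lambda>m. a m * complex_of_real (walk k (int m))) sums (deriv ^^ k) f 0" for k
    using sums_higher_deriv_dominated[OF holomorphic_bessel_I norm_bessel_I_le sums, of k]
    by (simp add: higher_deriv_bessel_I_0)
  then have "a l = (if l = 0 then 1 else 2) * chebyshev_op l (\<lambda>k. (deriv ^^ k) f 0) 0"
    by (rule walk_series_inversion)
  then have "norm (a l) \<le> 2 * norm (chebyshev_op l (\<lambda>k. (deriv ^^ k) f 0) 0)"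
    by (auto simp: norm_mult)
  also have "norm (chebyshev_op l (\<lambda>k. (deriv ^^ k) f 0) 0) \<le> c * \<alpha> ^ 0 * (2 * \<alpha> + 1) ^ l"
    by (rule norm_chebyshev_op_le) (use assms in auto)
  finally show ?thesis by simp
qed

lemma bessel_J_eq_bessel_I: "bessel_J l (\<i> * s) = \<i> ^ l * bessel_I l s"
  by (simp add: bessel_I_def flip: mult.assoc power_mult_distrib)

lemma basis_coeff_le:
  assumes hol: "f holomorphic_on UNIV"
    and sums: "\<And>s. (\<lambda>l. a l * basis_fun b l s) sums f s"
    and bound: "\<And>k. norm ((deriv ^^ k) f 0) \<le> c * \<alpha> ^ k" and "0 \<le> c" "0 \<le> \<alpha>"
  shows "norm (a l) \<le> 2 * c * (2 * \<alpha> + 1) ^ l"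
proof (cases b)
  case Monomials
  have "(\<lambda>m. a m * (deriv ^^ l) (\<lambda>s. s ^ m / fact m) 0) sums (deriv ^^ l) f 0"
  proof (rule sums_higher_deriv_dominated[where z\<^sub>0 = 2])
    show "norm (s ^ m / fact m) \<le> (1/2) ^ m * norm (2 ^ m / fact m :: complex)"
      if "norm s < 1" for m and s :: complex
      using that by (simp add: norm_divide norm_power power_one_over divide_right_mono power_le_one)
  qed (use sums Monomials in \<open>auto intro!: holomorphic_intros\<close>)
  moreover have "(deriv ^^ l) (\<lambda>s. s ^ m / fact m) 0 = (if m = l then 1 else 0 :: complex)" for m
  proof -
    have "(deriv ^^ l) (\<lambda>s. 1 / fact m * s ^ m) 0 = 1 / fact m * (deriv ^^ l) (\<lambda>s. s ^ m) (0 :: complex)"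
      by (intro higher_deriv_cmult[where A = UNIV] holomorphic_intros) auto
    also have "\<dots> = (if m = l then 1 else 0)"
      using higher_deriv_power[of l 0 m 0]
      by (cases m l rule: linorder_cases) (auto simp: pochhammer_0_left simp flip: pochhammer_fact)
    finally show ?thesis by simp
  qed
  ultimately have "(\<lambda>m. if m = l then a l else 0) sums (deriv ^^ l) f 0"
    by (simp add: if_distrib cong: if_cong)
  then have "a l = (deriv ^^ l) f 0"
    using sums_unique2 sums_single[of l "\<lambda>_. a l"] by force
  then have "norm (a l) \<le> c * \<alpha> ^ l"
    using bound by simp
  also have "\<dots> \<le> (2 * c) * (2 * \<alpha> + 1) ^ l"
    using assms by (intro mult_mono power_mono) auto
  finally show ?thesis .
next
  case Bessel
  have "norm (\<i> ^ l * a l) \<le> 2 * c * (2 * \<alpha> + 1) ^ l"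
  proof (rule modified_bessel_coeff_le[where f = "\<lambda>s. f (\<i> * s)"])
    show "(\<lambda>l. \<i> ^ l * a l * bessel_I l s) sums f (\<i> * s)" for s
      using sums[of "\<i> * s"] Bessel by (simp add: bessel_J_eq_bessel_I mult_ac)
    show "norm ((deriv ^^ k) (\<lambda>s. f (\<i> * s)) 0) \<le> c * \<alpha> ^ k" for k
      using bound[of k] higher_deriv_compose_linear[of f UNIV UNIV 0 \<i> k] hol
      by (simp add: norm_mult norm_power)
  qed (use assms in auto)
  then show ?thesis
    by (simp add: norm_mult norm_power)
next
  case Modified_Bessel
  then show ?thesis
    using modified_bessel_coeff_le[of a f c \<alpha> l] assms by simp
qed

section \<open>Exponential tails in a weighted norm\<close>

text \<open>
  The largest weighted column sum is the operator norm for the weighted \<open>\<ell>\<^sup>1\<close>-norm, hence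
  submultiplicative.
\<close>
lemma weighted_col_sum_power_le:
  fixes M :: "complex Matrix.mat" and \<omega> :: "nat \<Rightarrow> real"
  assumes M: "M \<in> carrier_mat D D" and \<omega>: "\<And>i. 0 \<le> \<omega> i"
    and col: "\<And>j. j < D \<Longrightarrow> (\<Sum>i<D. \<omega> i * norm (M $$ (i, j))) \<le> R * \<omega> j"
    and "0 \<le> R" and j: "j < D"
  shows "(\<Sum>i<D. \<omega> i * norm ((M ^\<^sub>m k) $$ (i, j))) \<le> R ^ k * \<omega> j"
  using j
proof (induction k arbitrary: j)
  case 0
  have "(\<Sum>i<D. \<omega> i * norm ((M ^\<^sub>m 0) $$ (i, j))) = (\<Sum>i<D. if i = j then \<omega> j else 0)"
    using 0 M by (intro sum.cong) auto
  then show ?case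
    using 0 by simp
next
  case (Suc k)
  have Mk: "M ^\<^sub>m k \<in> carrier_mat D D"
    using M by (rule pow_carrier_mat)
  have "(\<Sum>i<D. \<omega> i * norm ((M ^\<^sub>m Suc k) $$ (i, j)))
      \<le> (\<Sum>i<D. \<Sum>l<D. norm (M $$ (l, j)) * (\<omega> i * norm ((M ^\<^sub>m k) $$ (i, l))))"
  proof (rule sum_mono)
    fix i assume "i \<in> {..<D}"
    then have "(M ^\<^sub>m Suc k) $$ (i, j) = (\<Sum>l<D. (M ^\<^sub>m k) $$ (i, l) * M $$ (l, j))"
      using M Mk Suc.prems by (simp add: scalar_prod_def lessThan_atLeast0)
    then have "\<omega> i * norm ((M ^\<^sub>m Suc k) $$ (i, j))
        \<le> \<omega> i * (\<Sum>l<D. norm ((M ^\<^sub>m k) $$ (i, l) * M $$ (l, j)))"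
      using \<omega> by (auto intro!: mult_left_mono norm_sum)
    then show "\<omega> i * norm ((M ^\<^sub>m Suc k) $$ (i, j))
        \<le> (\<Sum>l<D. norm (M $$ (l, j)) * (\<omega> i * norm ((M ^\<^sub>m k) $$ (i, l))))"
      by (simp add: sum_distrib_left norm_mult mult_ac)
  qed
  also have "\<dots> = (\<Sum>l<D. norm (M $$ (l, j)) * (\<Sum>i<D. \<omega> i * norm ((M ^\<^sub>m k) $$ (i, l))))"
    by (subst sum.swap) (simp add: sum_distrib_left)
  also have "\<dots> \<le> (\<Sum>l<D. norm (M $$ (l, j)) * (R ^ k * \<omega> l))"
    using Suc.IH by (intro sum_mono mult_left_mono) auto
  also have "\<dots> = R ^ k * (\<Sum>l<D. \<omega> l * norm (M $$ (l, j)))"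
    by (simp add: sum_distrib_left mult_ac)
  also have "\<dots> \<le> R ^ k * (R * \<omega> j)"
    using col[OF Suc.prems] \<open>0 \<le> R\<close> by (intro mult_left_mono) auto
  finally show ?case
    by (simp add: mult_ac)
qed

lemma summable_exp_series_tail: "summable (\<lambda>k. (x::real) ^ (k + N) / fact (k + N))"
  using summable_ignore_initial_segment[OF summable_exp[of x], of N] by (simp add: field_simps)

lemma exp_series_tail_tendsto_0:
  "(\<lambda>N. \<Sum>k. (x::real) ^ (k + N) / fact (k + N)) \<longlonglongrightarrow> 0"
  using suminf_exist_split2[OF summable_exp[of x]] by (simp add: field_simps)

lemma exp_tail_carrier: "M \<in> carrier_mat D D \<Longrightarrow> exp_tail N M \<in> carrier_mat D D"
  by (auto simp: exp_tail_def)

lemma exp_tail_mult_vec_le: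
  fixes M :: "complex Matrix.mat" and \<omega> :: "nat \<Rightarrow> real"
  assumes M: "M \<in> carrier_mat D D" and \<omega>: "\<And>i. 0 \<le> \<omega> i"
    and col: "\<And>j. j < D \<Longrightarrow> (\<Sum>i<D. \<omega> i * norm (M $$ (i, j))) \<le> R * \<omega> j"
    and "0 \<le> R" and v: "v \<in> carrier_vec D" and i: "i < D" "\<omega> i = 1"
  shows "norm (vec_index (exp_tail N M *\<^sub>v v) i)
    \<le> (\<Sum>k. R ^ (k + N) / fact (k + N)) * (\<Sum>j<D. \<omega> j * norm (vec_index v j))"
proof -
  let ?T = "\<Sum>k. R ^ (k + N) / fact (k + N)"
  note S = summable_exp_series_tail[of R N]
  have entry: "norm (exp_tail N M $$ (i, j)) \<le> ?T * \<omega> j" if j: "j < D" for j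
  proof -
    have "norm ((M ^\<^sub>m (N + k)) $$ (i, j) / fact (N + k)) \<le> R ^ (k + N) / fact (k + N) * \<omega> j" for k
    proof -
      have "norm ((M ^\<^sub>m (N + k)) $$ (i, j)) = \<omega> i * norm ((M ^\<^sub>m (N + k)) $$ (i, j))"
        using i by simp
      also have "\<dots> \<le> (\<Sum>i<D. \<omega> i * norm ((M ^\<^sub>m (N + k)) $$ (i, j)))"
        using i \<omega> by (intro member_le_sum) auto
      also have "\<dots> \<le> R ^ (N + k) * \<omega> j"
        using M \<omega> col \<open>0 \<le> R\<close> j by (rule weighted_col_sum_power_le)
      finally show ?thesis
        by (simp add: norm_divide divide_right_mono add.commute)
    qed
    then have "norm (\<Sum>k. (M ^\<^sub>m (N + k)) $$ (i, j) / fact (N + k))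
        \<le> (\<Sum>k. R ^ (k + N) / fact (k + N) * \<omega> j)"
      by (intro norm_suminf_le summable_mult2 S)
    then show ?thesis
      using i j M S by (simp add: exp_tail_def suminf_mult2)
  qed
  have "vec_index (exp_tail N M *\<^sub>v v) i = (\<Sum>j<D. exp_tail N M $$ (i, j) * vec_index v j)"
    using i M v by (simp add: exp_tail_def scalar_prod_def lessThan_atLeast0)
  also have "norm \<dots> \<le> (\<Sum>j<D. ?T * \<omega> j * norm (vec_index v j))"
    using entry by (intro sum_norm_le) (auto simp: norm_mult intro!: mult_right_mono)
  finally show ?thesis
    by (simp only: sum_distrib_left mult.assoc)
qed

section \<open>The augmented matrices are uniformly bounded\<close>

lemma basis_mat_carrier: "basis_mat b N \<in> carrier_mat N N"
  by (cases b) auto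

text \<open>The only feature of the three basis matrices that matters for the growth of their powers.\<close>
lemma basis_mat_entry_le:
  assumes "i < N" "j < N"
  shows "\<bar>basis_mat b N $$ (i, j)\<bar> \<le> (if i = j + 1 then 1 else 0) + (if j = i + 1 then 1 else 0)"
  using assms by (cases b) auto

lemma basis_mat_weighted_col_sum_le:
  assumes "1 \<le> \<rho>" "j < N"
  shows "(\<Sum>i<N. \<rho> ^ i * \<bar>basis_mat b N $$ (i, j)\<bar>) \<le> (\<rho> + 1) * \<rho> ^ j"
proof -
  \<comment> \<open>For \<open>j = 0\<close> the index \<open>j - 1\<close> truncates to 0, which only adds a nonnegative term.\<close>
  have "(\<Sum>i<N. \<rho> ^ i * \<bar>basis_mat b N $$ (i, j)\<bar>)
      \<le> (\<Sum>i<N. (if i = j + 1 then \<rho> ^ (j + 1) else 0) + (if i = j - 1 then \<rho> ^ j else 0))"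
  proof (rule sum_mono)
    fix i assume "i \<in> {..<N}"
    then have "\<rho> ^ i * \<bar>basis_mat b N $$ (i, j)\<bar>
        \<le> \<rho> ^ i * ((if i = j + 1 then 1 else 0) + (if j = i + 1 then 1 else 0))"
      using assms by (intro mult_left_mono basis_mat_entry_le) auto
    also have "\<dots> \<le> (if i = j + 1 then \<rho> ^ (j + 1) else 0) + (if i = j - 1 then \<rho> ^ j else 0)"
      using assms by (auto simp: mult_le_cancel_right1)
    finally show "\<rho> ^ i * \<bar>basis_mat b N $$ (i, j)\<bar>
        \<le> (if i = j + 1 then \<rho> ^ (j + 1) else 0) + (if i = j - 1 then \<rho> ^ j else 0)" .
  qed
  also have "\<dots> \<le> \<rho> ^ (j + 1) + \<rho> ^ j"
    using assms by (auto simp: sum.distrib)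
  finally show ?thesis
    by (simp add: algebra_simps)
qed

definition block_weight :: "nat \<Rightarrow> real \<Rightarrow> nat \<Rightarrow> real" where
  "block_weight n \<rho> i = (if i < n then 1 else \<rho> ^ (i - n))"

lemma sum_lessThan_add: "(\<Sum>i<n + N. f i) = (\<Sum>i<n. f i) + (\<Sum>i<N. f (n + i))"
  for f :: "nat \<Rightarrow> real"
  by (induction N) (auto simp: algebra_simps)

text \<open>
  A column through \<open>A\<close> contributes at most the sum of the moduli of all entries of \<open>A\<close>. A column through
  \<open>w\<^sub>l\<close> has weight \<open>\<rho>\<^sup>l\<close>, which up to
  constant factors bounds the entries of \<open>w\<^sub>l\<close> and equals the neighbouring weights.
\<close>
lemma augmented_mat_weighted_col_sum_le:
  assumes A: "A \<in> carrier_mat n n" and "1 \<le> \<rho>"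
    and w: "\<And>l i. i < n \<Longrightarrow> norm (vec_index (w l) i) \<le> K * \<rho> ^ l" "\<And>l. w l \<in> carrier_vec n"
    and j: "j < n + N" and "0 \<le> K"
  shows "(\<Sum>i<n + N. block_weight n \<rho> i * norm (augmented_mat b n A w N $$ (i, j)))
    \<le> ((\<Sum>i<n. \<Sum>j<n. norm (A $$ (i, j))) + of_nat n * K + \<rho> + 1) * block_weight n \<rho> j"
    (is "?L \<le> (?a + _ + _ + _) * _")
proof -
  have a: "0 \<le> ?a"
    by (intro sum_nonneg) auto
  have W: "coeff_mat n w N \<in> carrier_mat n N"
    by (auto simp: coeff_mat_def)
  let ?H = "map_mat complex_of_real (basis_mat b N)"
  have H: "?H \<in> carrier_mat N N"
    using basis_mat_carrier[of b N] by simp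
  have L: "?L = (\<Sum>i<n. norm (augmented_mat b n A w N $$ (i, j)))
      + (\<Sum>i<N. \<rho> ^ i * norm (augmented_mat b n A w N $$ (n + i, j)))"
    by (simp add: sum_lessThan_add block_weight_def)
  show ?thesis
  proof (cases "j < n")
    case True
    have "(\<Sum>i<n. norm (augmented_mat b n A w N $$ (i, j))) = (\<Sum>i<n. norm (A $$ (i, j)))"
      using True A W H by (intro sum.cong) (auto simp: augmented_mat_def)
    also have "\<dots> \<le> ?a"
      using True by (intro sum_mono member_le_sum) auto
    moreover have "(\<Sum>i<N. \<rho> ^ i * norm (augmented_mat b n A w N $$ (n + i, j))) = 0"
      using True A W H by (intro sum.neutral) (auto simp: augmented_mat_def)
    ultimately have "?L \<le> ?a"
      using L by linarith
    then show ?thesis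
      using True \<open>0 \<le> K\<close> \<open>1 \<le> \<rho>\<close> by (simp add: block_weight_def add_increasing2)
  next
    case False
    define l where "l = j - n"
    have l: "j = n + l" "l < N"
      using False j by (auto simp: l_def)
    have "(\<Sum>i<n. norm (augmented_mat b n A w N $$ (i, j))) = (\<Sum>i<n. norm (vec_index (w l) i))"
      using l A W H w(2) by (intro sum.cong) (auto simp: augmented_mat_def coeff_mat_def mat_of_cols_index)
    also have "\<dots> \<le> of_nat n * K * \<rho> ^ l"
      using sum_bounded_above[of "{..<n}" "\<lambda>i. norm (vec_index (w l) i)" "K * \<rho> ^ l"] w(1) by simp
    moreover have "(\<Sum>i<N. \<rho> ^ i * norm (augmented_mat b n A w N $$ (n + i, j)))
        = (\<Sum>i<N. \<rho> ^ i * \<bar>basis_mat b N $$ (i, l)\<bar>)"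
      using l A W H basis_mat_carrier[of b N] by (intro sum.cong) (auto simp: augmented_mat_def)
    moreover have "\<dots> \<le> (\<rho> + 1) * \<rho> ^ l"
      using \<open>1 \<le> \<rho>\<close> l by (intro basis_mat_weighted_col_sum_le)
    ultimately have "?L \<le> (of_nat n * K + \<rho> + 1) * \<rho> ^ l"
      using L by (simp add: algebra_simps)
    also have "\<dots> \<le> (?a + of_nat n * K + \<rho> + 1) * \<rho> ^ l"
      using a \<open>1 \<le> \<rho>\<close> by (intro mult_right_mono) auto
    finally show ?thesis
      using l by (simp add: block_weight_def)
  qed
qed

lemma first_block_proj_mult_vec_index:
  assumes "v \<in> carrier_vec (n + N)" "i < n"
  shows "vec_index (first_block_proj n N *\<^sub>v v) i = vec_index v i"
proof -
  have "vec_index (first_block_proj n N *\<^sub>v v) i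
      = (\<Sum>j<n + N. (if i = j then 1 else 0) * vec_index v j)"
    using assms by (simp add: first_block_proj_def scalar_prod_def lessThan_atLeast0)
  also have "\<dots> = (\<Sum>j<n + N. if j = i then vec_index v j else 0)"
    by (intro sum.cong) auto
  finally show ?thesis
    using assms by simp
qed

lemma exp_remainder_index_le:
  assumes A: "A \<in> carrier_mat n n" and u0: "u0 \<in> carrier_vec n" and "1 \<le> \<rho>"
    and w: "\<And>l i. i < n \<Longrightarrow> norm (vec_index (w l) i) \<le> K * \<rho> ^ l" "\<And>l. w l \<in> carrier_vec n"
    and "0 \<le> K" "0 \<le> t" "i < n"
  defines "R \<equiv> (\<Sum>i<n. \<Sum>j<n. norm (A $$ (i, j))) + of_nat n * K + \<rho> + 1"
  shows "norm (vec_index (exp_remainder b n A w u0 t N) i)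
    \<le> (\<Sum>k. (t * R) ^ (k + N) / fact (k + N)) * ((\<Sum>j<n. norm (vec_index u0 j)) + 1)"
proof -
  let ?A = "augmented_mat b n A w N" and ?v = "u0 @\<^sub>v unit_vec N 0 :: complex Matrix.vec"
  let ?M = "complex_of_real t \<cdot>\<^sub>m ?A" and ?\<omega> = "block_weight n \<rho>"
  have AN: "?A \<in> carrier_mat (n + N) (n + N)"
    using A basis_mat_carrier[of b N] by (auto simp: augmented_mat_def)
  have v: "?v \<in> carrier_vec (n + N)"
    using u0 by simp
  have R: "0 \<le> R"
    unfolding R_def using assms by (intro add_nonneg_nonneg sum_nonneg) auto
  have \<omega>: "0 \<le> ?\<omega> i" for i
    using \<open>1 \<le> \<rho>\<close> by (simp add: block_weight_def)
  have col: "(\<Sum>i<n + N. ?\<omega> i * norm (?M $$ (i, j))) \<le> t * R * ?\<omega> j" if j: "j < n + N" for j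
  proof -
    have "(\<Sum>i<n + N. ?\<omega> i * norm (?M $$ (i, j))) = t * (\<Sum>i<n + N. ?\<omega> i * norm (?A $$ (i, j)))"
      using AN j \<open>0 \<le> t\<close> by (auto simp: norm_mult sum_distrib_left mult_ac intro!: sum.cong)
    also have "\<dots> \<le> t * (R * ?\<omega> j)"
      unfolding R_def using assms j
      by (intro mult_left_mono augmented_mat_weighted_col_sum_le) auto
    finally show ?thesis by (simp add: mult_ac)
  qed
  have "(\<Sum>j<n + N. ?\<omega> j * norm (vec_index ?v j))
      = (\<Sum>j<n. norm (vec_index u0 j)) + (\<Sum>j<N. \<rho> ^ j * norm (vec_index (unit_vec N 0) j :: complex))"
    using u0 by (simp add: sum_lessThan_add block_weight_def)
  also have "(\<Sum>j<N. \<rho> ^ j * norm (vec_index (unit_vec N 0) j :: complex)) = (\<Sum>j<N. if j = 0 then 1 else 0)"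
    by (intro sum.cong) auto
  also have "\<dots> \<le> 1"
    by simp
  finally have V: "(\<Sum>j<n + N. ?\<omega> j * norm (vec_index ?v j)) \<le> (\<Sum>j<n. norm (vec_index u0 j)) + 1"
    by simp
  have "vec_index (exp_remainder b n A w u0 t N) i = vec_index (exp_tail N ?M *\<^sub>v ?v) i"
    unfolding exp_remainder_def
    by (rule first_block_proj_mult_vec_index
          [OF mult_mat_vec_carrier[OF exp_tail_carrier[OF smult_carrier_mat[OF AN]] v] \<open>i < n\<close>])
  also have "norm \<dots> \<le> (\<Sum>k. (t * R) ^ (k + N) / fact (k + N))
      * (\<Sum>j<n + N. ?\<omega> j * norm (vec_index ?v j))"
    using AN v R \<omega> col \<open>0 \<le> t\<close> \<open>i < n\<close>
    by (intro exp_tail_mult_vec_le) (auto simp: block_weight_def)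
  also have "\<dots> \<le> (\<Sum>k. (t * R) ^ (k + N) / fact (k + N)) * ((\<Sum>j<n. norm (vec_index u0 j)) + 1)"
    using R \<open>0 \<le> t\<close>
    by (intro mult_left_mono V suminf_nonneg summable_exp_series_tail) auto
  finally show ?thesis .
qed

theorem theorem13:
  fixes b :: basis_family
    and n :: nat
    and A :: "complex Matrix.mat"
    and u0 :: "complex Matrix.vec"
    and g :: "complex \<Rightarrow> complex Matrix.vec"
    and w :: "nat \<Rightarrow> complex Matrix.vec"
    and c t :: real
  assumes A: "A \<in> carrier_mat n n"
    and u0: "u0 \<in> carrier_vec n"
    and g: "\<And>s. g s \<in> carrier_vec n"
    and entire: "\<And>i. i < n \<Longrightarrow> (\<lambda>s. vec_index (g s) i) holomorphic_on UNIV"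
    and w: "\<And>l. w l \<in> carrier_vec n"
    and expansion: "\<And>s i. i < n \<Longrightarrow>
      (\<lambda>l. vec_index (w l) i * basis_fun b l s) sums vec_index (g s) i"
    and bound: "\<And>l. vec_nrm (vec_deriv n l g 0) \<le> c * spectral_nrm A ^ l"
    and t: "0 \<le> t"
  shows "(\<lambda>N. vec_nrm (exp_remainder b n A w u0 t N)) \<longlonglongrightarrow> 0"
proof -
  \<comment> \<open>Absolute values guarantee \<open>\<alpha> \<ge> 0\<close>, \<open>K \<ge> 0\<close> and \<open>\<rho> \<ge> 1\<close> without evaluating the supremum.\<close>
  define \<alpha> where "\<alpha> = \<bar>spectral_nrm A\<bar>"
  define K where "K = 2 * \<bar>c\<bar>"
  define \<rho> where "\<rho> = 2 * \<alpha> + 1"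
  define R where "R = (\<Sum>i<n. \<Sum>j<n. norm (A $$ (i, j))) + of_nat n * K + \<rho> + 1"
  have deriv_le: "norm ((deriv ^^ l) (\<lambda>s. vec_index (g s) i) 0) \<le> \<bar>c\<bar> * \<alpha> ^ l" if "i < n" for l i
  proof -
    have "norm ((deriv ^^ l) (\<lambda>s. vec_index (g s) i) 0)
        = sqrt ((norm (vec_index (vec_deriv n l g 0) i))\<^sup>2)"
      using that by (simp add: vec_deriv_def)
    also have "\<dots> \<le> vec_nrm (vec_deriv n l g 0)"
      unfolding vec_nrm_def using that
      by (intro real_sqrt_le_mono member_le_sum) (auto simp: vec_deriv_def)
    also have "\<dots> \<le> \<bar>c * spectral_nrm A ^ l\<bar>"
      using bound[of l] by linarith
    finally show ?thesis
      by (simp add: \<alpha>_def abs_mult power_abs)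
  qed
  have w_le: "norm (vec_index (w l) i) \<le> K * \<rho> ^ l" if "i < n" for l i
    unfolding K_def \<rho>_def
    using entire[OF that] expansion[OF that] deriv_le[OF that]
    by (rule basis_coeff_le) (auto simp: \<alpha>_def)
  have entry: "(\<lambda>N. vec_index (exp_remainder b n A w u0 t N) i) \<longlonglongrightarrow> 0" if "i < n" for i
  proof (rule Lim_null_comparison)
    show "\<forall>\<^sub>F N in sequentially. norm (vec_index (exp_remainder b n A w u0 t N) i)
        \<le> (\<Sum>k. (t * R) ^ (k + N) / fact (k + N)) * ((\<Sum>j<n. norm (vec_index u0 j)) + 1)"
      unfolding R_def using A u0 w w_le t that
      by (intro always_eventually allI exp_remainder_index_le) (auto simp: K_def \<rho>_def \<alpha>_def)
    show "(\<lambda>N. (\<Sum>k. (t * R) ^ (k + N) / fact (k + N)) * ((\<Sum>j<n. norm (vec_index u0 j)) + 1))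
        \<longlonglongrightarrow> 0"
      by (intro tendsto_mult_left_zero exp_series_tail_tendsto_0)
  qed
  have "(\<lambda>N. sqrt (\<Sum>i<n. (norm (vec_index (exp_remainder b n A w u0 t N) i))\<^sup>2))
      \<longlonglongrightarrow> sqrt (\<Sum>i<n. (norm (0::complex))\<^sup>2)"
    using entry by (intro tendsto_intros) auto
  then show ?thesis
    by (simp add: vec_nrm_def exp_remainder_def first_block_proj_def)
qed

end
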